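(* Let $k\ge 3$ and let $H(x)=x\ln x+(1-x)\ln(1-x)$. Let $\theta_k$ denote the minimum over $[0,1/2]$ of the function $$f_k(x)=\frac{\ln 2+H(x)}{\ln\bigl(1+(1-2x)^k\bigr)}.$$ For each $n$ and $L$, let $A$ be chosen uniformly at random from the set $M_{L,n,k}$ of Boolean $L\times n$ matrices with exactly $k$ ones in each row, let $Y(A)$ be the number of vectors in the kernel of $A^{T}$ over $GF(2)$, and let $E_{L,k}(Y)$ be its expectation. Then for every real $c$ with $0<c<\theta_k$, $\lim_{n\to\infty}E_{cn,k}(Y)=1$ (where $L=cn$ is rounded to an integer).
   Context: Conventions: $0\ln 0=0$, and at $x=1/2$ (where numerator and denominator of $f_k$ both vanish) $f_k$ is understood by its limit, which is $+\infty$ for $k\ge3$. *)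

theory Defs
  imports
    "HOL-Library.Z2"
    "HOL-Library.Extended_Real"
    "HOL-Real_Asymp.Real_Asymp"
    "HOL-Probability.Probability"
    "Jordan_Normal_Form.Matrix_Kernel"
begin

text \<open>Since \<open>ln 0 = 0\<close> in HOL, the convention \<open>0 ln 0 = 0\<close> holds automatically.\<close>

definition H :: "real \<Rightarrow> real" where
  "H x = x * ln x + (1 - x) * ln (1 - x)"

text \<open>At \<open>1/2\<close> the quotient is \<open>0/0\<close>, which is \<open>0\<close> in HOL, hence the explicit value there.
  For \<open>k \<ge> 3\<close> it is the limit of the quotient; see \<open>f_tendsto_half\<close> below.\<close>

definition f :: "nat \<Rightarrow> real \<Rightarrow> ereal" where
  "f k x = (if x = 1/2 then \<infinity> else ereal ((ln 2 + H x) / ln (1 + (1 - 2 * x) ^ k)))"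

text \<open>The infimum is attained for \<open>k \<ge> 3\<close>; see \<open>theta_is_minimum\<close> below.\<close>

definition theta :: "nat \<Rightarrow> ereal" where
  "theta k = (INF x\<in>{0..1/2}. f k x)"

definition M :: "nat \<Rightarrow> nat \<Rightarrow> nat \<Rightarrow> bit mat set" where
  "M L n k = {A \<in> carrier_mat L n. \<forall>i<L. card {j. j < n \<and> A $$ (i, j) = 1} = k}"

definition Y :: "bit mat \<Rightarrow> nat" where
  "Y A = card (mat_kernel (transpose_mat A))"

text \<open>Meaningful if \<open>M L n k\<close> is nonempty, in particular for all \<open>n \<ge> k\<close>
  (see \<open>finite_M\<close> and \<open>M_nonempty\<close>).\<close>

definition expected_Y :: "nat \<Rightarrow> nat \<Rightarrow> nat \<Rightarrow> real" where
  "expected_Y L n k = measure_pmf.expectation (pmf_of_set (M L n k)) (\<lambda>A. real (Y A))"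

lemma finite_M: "finite (M L n k)"
proof -
  have fin: "finite (UNIV :: bit set)"
  proof (rule finite_subset)
    show "UNIV \<subseteq> {0, 1 :: bit}"
      using bit_not_zero_iff by blast
  qed simp
  have "A \<in> (\<lambda>g. mat L n g) ` (({..<L} \<times> {..<n}) \<rightarrow>\<^sub>E UNIV)" if "A \<in> carrier_mat L n" for A :: "bit mat"
  proof (rule image_eqI)
    show "A = mat L n (restrict (\<lambda>p. A $$ p) ({..<L} \<times> {..<n}))"
      using that by (intro eq_matI) auto
  qed auto
  then have "carrier_mat L n \<subseteq> (\<lambda>g. mat L n g) ` (({..<L} \<times> {..<n}) \<rightarrow>\<^sub>E (UNIV :: bit set))"
    by blast
  moreover have "finite ((\<lambda>g. mat L n g) ` (({..<L} \<times> {..<n}) \<rightarrow>\<^sub>E (UNIV :: bit set)))"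
    using fin by (intro finite_imageI finite_PiE) auto
  ultimately have "finite (carrier_mat L n :: bit mat set)"
    by (rule finite_subset)
  then show ?thesis
    by (rule finite_subset[rotated]) (auto simp: M_def)
qed

lemma M_nonempty:
  assumes "k \<le> n"
  shows "M L n k \<noteq> {}"
proof -
  let ?A = "mat L n (\<lambda>(i, j). if j < k then 1 else 0) :: bit mat"
  have "{j. j < n \<and> ?A $$ (i, j) = 1} = {..<k}" if "i < L" for i
    using that assms by (auto split: if_splits)
  then have "?A \<in> M L n k"
    by (simp add: M_def)
  then show ?thesis by blast
qed

lemma f_tendsto_half:
  assumes "k \<ge> 3"
  shows "(f k \<longlongrightarrow> f k (1/2)) (at_left (1/2))"
proof -
  let ?q = "\<lambda>x. (ln 2 + H x) / ln (1 + (1 - 2 * x) ^ k)"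
  have ev: "eventually (\<lambda>x::real. x \<in> {0<..<1/2}) (at_left (1/2))"
    by (intro eventually_at_leftI[of 0]) auto
  have H': "ln 2 + H x = x * ln (2 * x) + (1 - x) * ln (2 * (1 - x))" if "x \<in> {0<..<1/2}" for x
  proof -
    have "ln (2 * x) = ln 2 + ln x" "ln (2 * (1 - x)) = ln 2 + ln (1 - x)"
      using that by (intro ln_mult_pos; simp)+
    then show ?thesis by (simp only: H_def) (simp add: algebra_simps)
  qed
  have "filterlim (\<lambda>x::real. (x * ln (2 * x) + (1 - x) * ln (2 * (1 - x))) / (1 - 2 * x) ^ 3)
      at_top (at_left (1/2))"
    by real_asymp
  then have lim: "filterlim (\<lambda>x::real. (ln 2 + H x) / (1 - 2 * x) ^ 3) at_top (at_left (1/2))"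
    by (rule filterlim_cong[THEN iffD1, rotated -1])
      (use ev in \<open>auto elim!: eventually_mono simp: H'\<close>)
  have pos: "eventually (\<lambda>x::real. (ln 2 + H x) / (1 - 2 * x) ^ 3 > 0) (at_left (1/2))"
    using lim by (simp add: filterlim_at_top_dense)
  have "eventually (\<lambda>x. (ln 2 + H x) / (1 - 2 * x) ^ 3 \<le> ?q x) (at_left (1/2))"
    using ev pos
  proof eventually_elim
    case (elim x)
    then have u: "0 < 1 - 2 * x" "1 - 2 * x \<le> 1" by auto
    have 1: "0 < (1 - 2 * x) ^ k" using u by simp
    have 2: "ln (1 + (1 - 2 * x) ^ k) \<le> (1 - 2 * x) ^ k"
      using 1 by (intro ln_add_one_self_le_self) simp
    have 3: "(1 - 2 * x) ^ k \<le> (1 - 2 * x) ^ 3"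
      using u assms by (intro power_decreasing) auto
    have 4: "0 < ln (1 + (1 - 2 * x) ^ k)" using 1 by simp
    have "ln 2 + H x > 0" using elim(2) u by (simp add: zero_less_divide_iff)
    with 2 3 4 u show ?case
      by (intro divide_left_mono mult_pos_pos) auto
  qed
  then have "filterlim ?q at_top (at_left (1/2))"
    by (rule filterlim_at_top_mono[OF lim])
  then have "((\<lambda>x. ereal (?q x)) \<longlongrightarrow> \<infinity>) (at_left (1/2))"
    by (simp add: tendsto_PInfty_eq_at_top)
  moreover have "eventually (\<lambda>x. ereal (?q x) = f k x) (at_left (1/2))"
    using ev by eventually_elim (auto simp: f_def)
  ultimately have "(f k \<longlongrightarrow> \<infinity>) (at_left (1/2))"
    by (rule Lim_transform_eventually)
  then show ?thesis by (simp add: f_def)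
qed

lemma theta_is_minimum:
  assumes "k \<ge> 3"
  shows "\<exists>x\<in>{0..1/2}. f k x = theta k \<and> (\<forall>y\<in>{0..1/2}. f k x \<le> f k y)"
proof -
  let ?q = "\<lambda>x. (ln 2 + H x) / ln (1 + (1 - 2 * x) ^ k)"
  have f0: "f k 0 = 1" by (simp add: f_def H_def one_ereal_def)
  have "eventually (\<lambda>x. f k x > 1) (at_left (1/2))"
    using f_tendsto_half[OF assms] by (rule order_tendstoD) (simp add: f_def)
  then obtain b where b: "b < 1/2" "\<And>x. b < x \<Longrightarrow> x < 1/2 \<Longrightarrow> f k x > 1"
    by (auto simp: eventually_at_left_field)
  define d where "d = max 0 b"
  have d: "0 \<le> d" "d < 1/2" "\<And>x. d < x \<Longrightarrow> x \<le> 1/2 \<Longrightarrow> f k x > 1"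
    using b by (auto simp: d_def f_def)
  have xlnx: "continuous (at x within {0..}) (\<lambda>x::real. x * ln x)" if "x \<ge> 0" for x
  proof (cases "x = 0")
    case True
    have "((\<lambda>x::real. x * ln x) \<longlongrightarrow> 0) (at_right 0)" by real_asymp
    then show ?thesis using True
      by (simp add: continuous_within at_within_Ici_at_right)
  next
    case False
    then show ?thesis using that by (intro continuous_intros) auto
  qed
  then have "continuous_on {0..} (\<lambda>x::real. x * ln x)"
    by (auto simp: continuous_on_eq_continuous_within)
  then have "continuous_on {0..d} (\<lambda>x::real. x * ln x)"
    by (rule continuous_on_subset) auto
  moreover have "continuous_on {0..d} (\<lambda>x::real. (1 - x) * ln (1 - x))"
    using d by (intro continuous_intros) auto
  ultimately have "continuous_on {0..d} (\<lambda>x. x * ln x + (1 - x) * ln (1 - x))"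
    by (rule continuous_on_add)
  then have cH: "continuous_on {0..d} H"
    by (simp add: H_def[abs_def])
  have pos: "(1 - 2 * x) ^ k > 0" if "x \<in> {0..d}" for x
    using that d by auto
  have "continuous_on {0..d} ?q"
  proof (intro continuous_intros cH ballI)
    fix x assume "x \<in> {0..d}"
    then have "1 + (1 - 2 * x) ^ k > 1" using pos by fastforce
    then show "1 + (1 - 2 * x) ^ k \<noteq> 0" "ln (1 + (1 - 2 * x) ^ k) \<noteq> 0"
      by (linarith, metis ln_gt_zero less_irrefl)
  qed
  then obtain x where x: "x \<in> {0..d}" "\<And>y. y \<in> {0..d} \<Longrightarrow> ?q x \<le> ?q y"
    using continuous_attains_inf[of "{0..d}" ?q] d by (auto simp: Ball_def)
  have le: "f k x \<le> f k y" if "y \<in> {0..d}" for y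
    using x(1) x(2)[OF that] that d by (simp add: f_def)
  have "f k x \<le> 1" using le[of 0] f0 d by simp
  then have min: "f k x \<le> f k y" if "y \<in> {0..1/2}" for y
    using le[of y] d(3)[of y] that by (cases "y \<le> d") (auto intro: order.trans less_imp_le)
  moreover have mem: "x \<in> {0..1/2}" using x d by auto
  moreover have "f k x = theta k"
    unfolding theta_def using min mem by (intro antisym INF_greatest INF_lower) auto
  ultimately show ?thesis by blast
qed

end

theory Submission
  imports Defs
begin

text \<open>
  Expanding the indicator of the kernel in characters of \<open>GF(2)\<^sup>n\<close> gives
  \<open>E(Y) = 2\<^sup>-\<^sup>n \<Sum>\<^sub>U (1 + \<lambda>\<^sub>U)\<^sup>L\<close>, where \<open>U\<close> ranges over the subsets of \<open>{..<n}\<close> and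
  \<open>\<lambda>\<^sub>U\<close> is the \<open>k\<close>-th elementary symmetric polynomial of the signs \<open>\<chi>\<^sub>U\<close> divided by
  \<open>n choose k\<close> (a normalised Krawtchouk value). With \<open>x = |U| / n\<close>, the three-term recurrence
  yields \<open>|\<lambda>\<^sub>U| \<le> |1 - 2x|\<^sup>k + O(1/n)\<close>, and also \<open>|\<lambda>\<^sub>U| = O((T/n)\<^sup>k)\<close> as soon as
  \<open>T \<ge> |n - 2|U||\<close> and \<open>T\<^sup>2 \<ge> n\<close>. Take \<open>T = n\<^sup>3\<^sup>/\<^sup>5\<close>. For \<open>|n - 2|U|| \<le> T\<close> the second bound
  gives \<open>L \<lambda>\<^sub>U = O(n\<^sup>-\<^sup>1\<^sup>/\<^sup>5)\<close> because \<open>k \<ge> 3\<close>, so these terms contribute at most \<open>1 + o(1)\<close>.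
  For the other \<open>U\<close>, choosing \<open>c < t < \<theta>\<^sub>k\<close> turns the first bound into
  \<open>(1 + \<lambda>\<^sub>U)\<^sup>L \<le> O(1) exp((c/t) n (ln 2 + H x))\<close>, which loses exponentially in
  \<open>n (1 - 2x)\<^sup>2 \<ge> n\<^sup>1\<^sup>/\<^sup>5\<close> against \<open>2\<^sup>-\<^sup>n (n choose |U|) \<le> exp(-n (ln 2 + H x))\<close>.
  The matching lower bound is \<open>Y \<ge> 1\<close>.
\<close>

subsection \<open>Elementary symmetric polynomials of signs\<close>

text \<open>For \<open>y = chi U\<close> on \<open>{..<n}\<close> the value depends on
  \<open>U\<close> only through \<open>card U\<close>; it is the binary Krawtchouk polynomial of
  degree \<open>k\<close> at \<open>card U\<close>. Working over an arbitrary finite set permits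
  induction by inserting one point.\<close>

definition esym :: "('a \<Rightarrow> real) \<Rightarrow> 'a set \<Rightarrow> nat \<Rightarrow> real" where
  "esym y A k = (\<Sum>S | S \<subseteq> A \<and> card S = k. \<Prod>j\<in>S. y j)"

lemma esym_0:
  assumes "finite A"
  shows "esym y A 0 = 1"
proof -
  have "{S. S \<subseteq> A \<and> card S = 0} = {{}}"
    using assms by (auto simp: card_eq_0_iff dest: finite_subset)
  then show ?thesis by (simp add: esym_def)
qed

lemma esym_empty_Suc: "esym y {} (Suc k) = 0"
  unfolding esym_def by (rule sum.neutral) auto

lemma esym_insert:
  assumes "finite A" "a \<notin> A"
  shows "esym y (insert a A) (Suc k) = esym y A (Suc k) + y a * esym y A k"
proof -
  let ?P = "{S. S \<subseteq> A \<and> card S = Suc k}" and ?Q = "{S. S \<subseteq> A \<and> card S = k}"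
  have fin: "finite S" "a \<notin> S" if "S \<subseteq> A" for S
    using that assms by (auto dest: finite_subset)
  have eq: "{S. S \<subseteq> insert a A \<and> card S = Suc k} = ?P \<union> insert a ` ?Q"
  proof (intro equalityI subsetI)
    fix S assume S: "S \<in> {S. S \<subseteq> insert a A \<and> card S = Suc k}"
    show "S \<in> ?P \<union> insert a ` ?Q"
    proof (cases "a \<in> S")
      case True
      with S have "S = insert a (S - {a})" "S - {a} \<in> ?Q" by auto
      then show ?thesis by blast
    qed (use S in auto)
  qed (auto simp: fin)
  have "inj_on (insert a) ?Q"
    by (intro inj_onI) (metis (mono_tags, lifting) Diff_insert_absorb fin(2) mem_Collect_eq)
  then have "(\<Sum>S\<in>insert a ` ?Q. \<Prod>j\<in>S. y j) = (\<Sum>S\<in>?Q. y a * (\<Prod>j\<in>S. y j))"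
    by (subst sum.reindex) (auto intro!: sum.cong simp: fin)
  moreover have "?P \<inter> insert a ` ?Q = {}" using assms by blast
  moreover have "finite ?P" "finite ?Q" using assms by auto
  ultimately show ?thesis
    unfolding esym_def eq by (subst sum.union_disjoint) (auto simp: sum_distrib_left)
qed

lemma esym_1:
  assumes "finite A"
  shows "esym y A (Suc 0) = (\<Sum>j\<in>A. y j)"
  using assms by (induction A) (simp_all add: esym_empty_Suc esym_insert esym_0)

text \<open>Expand the product of the sum of the \<open>y j\<close> with
  \<open>esym y A (k + 1)\<close>. A factor \<open>y j\<close> with \<open>j\<close> outside
  \<open>S\<close> enlarges \<open>S\<close>, and each set of size \<open>k + 2\<close> arises
  \<open>k + 2\<close> times. With \<open>j\<close> in \<open>S\<close> the square cancels, and each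
  set of size \<open>k\<close> arises \<open>card A - k\<close> times. The formal proof is an
  induction on \<open>A\<close> instead.\<close>

lemma esym_recurrence:
  assumes "finite A" "\<And>j. j \<in> A \<Longrightarrow> (y j)\<^sup>2 = 1"
  shows "real (k + 2) * esym y A (k + 2) =
    (\<Sum>j\<in>A. y j) * esym y A (k + 1) - (real (card A) - real k) * esym y A k"
  using assms
proof (induction A arbitrary: k)
  case empty
  then show ?case by (cases k) (simp_all add: esym_empty_Suc)
next
  case (insert a A)
  then have sq: "y a * y a = 1" by (simp add: power2_eq_square)
  have IH: "real (k + 2) * esym y A (k + 2) =
    (\<Sum>j\<in>A. y j) * esym y A (k + 1) - (real (card A) - real k) * esym y A k" for k
    using insert by auto
  show ?case
  proof (cases k)
    case 0
    then show ?thesis using insert.hyps IH[of 0] sq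
      by (simp add: esym_insert esym_0 esym_1 eval_nat_numeral) (simp add: algebra_simps)
  next
    case (Suc l)
    define e0 e1 e2 e3 s N where d:
      "e0 = esym y A l" "e1 = esym y A (l + 1)" "e2 = esym y A (l + 2)" "e3 = esym y A (l + 3)"
      "s = (\<Sum>j\<in>A. y j)" "N = real (card A)"
    have 1: "(real l + 2) * e2 = s * e1 - (N - real l) * e0"
      using IH[of l] by (simp add: d algebra_simps)
    have 2: "(real l + 3) * e3 = s * e2 - (N - (real l + 1)) * e1"
      using IH[of "l + 1"] by (simp add: d eval_nat_numeral algebra_simps)
    \<comment> \<open>The right-hand side for \<open>insert a A\<close> regroups into the hypothesis
      at \<open>l + 1\<close> plus \<open>y a\<close> times the hypothesis at \<open>l\<close>; what
      is left over is \<open>y a * e2\<close> and a multiple of \<open>y a * y a - 1\<close>, which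
      is zero.\<close>
    have "(y a + s) * (e2 + y a * e1) - (N + 1 - (real l + 1)) * (e1 + y a * e0)
        = (s * e2 - (N - (real l + 1)) * e1) + y a * (s * e1 - (N - real l) * e0)
          + y a * e2 + (y a * y a - 1) * e1"
      by (simp add: algebra_simps)
    also have "\<dots> = (real l + 3) * (e3 + y a * e2)"
      unfolding 1[symmetric] 2[symmetric] sq by (simp add: algebra_simps)
    finally have "(real l + 3) * (e3 + y a * e2) =
      (y a + s) * (e2 + y a * e1) - (N + 1 - (real l + 1)) * (e1 + y a * e0)" ..
    then show ?thesis using insert.hyps Suc
      by (simp add: d esym_insert eval_nat_numeral algebra_simps)
  qed
qed

lemma abs_esym_recurrence:
  assumes "finite A" "\<And>j. j \<in> A \<Longrightarrow> (y j)\<^sup>2 = 1"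
  shows "real (k + 2) * \<bar>esym y A (k + 2)\<bar> \<le>
    \<bar>\<Sum>j\<in>A. y j\<bar> * \<bar>esym y A (k + 1)\<bar> + real (card A) * \<bar>esym y A k\<bar>"
proof -
  have "\<bar>(real (card A) - real k) * esym y A k\<bar> \<le> real (card A) * \<bar>esym y A k\<bar>"
  proof (cases "k \<le> card A")
    case True
    then show ?thesis by (simp add: abs_mult mult_right_mono)
  next
    \<comment> \<open>Here the coefficient is negative and may exceed \<open>card A\<close> in
      absolute value, but there are no subsets of size \<open>k\<close>, so \<open>esym\<close> is
      an empty sum.\<close>
    case False
    then have "{S. S \<subseteq> A \<and> card S = k} = {}"
      using card_mono[OF assms(1)] by auto
    then show ?thesis by (simp only: esym_def sum.empty)
  qed
  then have "\<bar>(\<Sum>j\<in>A. y j) * esym y A (k + 1) - (real (card A) - real k) * esym y A k\<bar>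
      \<le> \<bar>\<Sum>j\<in>A. y j\<bar> * \<bar>esym y A (k + 1)\<bar> + real (card A) * \<bar>esym y A k\<bar>"
    by (intro order.trans[OF abs_triangle_ineq4] add_mono) (simp_all add: abs_mult)
  then show ?thesis
    by (simp only: esym_recurrence[OF assms, symmetric] abs_mult abs_of_nat)
qed

text \<open>The hypothesis on \<open>card A\<close> makes both terms of the recurrence at most
  \<open>T ^ (l + 2)\<close>; the resulting factor 2 is absorbed by the coefficient
  \<open>l + 2\<close> on the left. This is the useful bound when the signs nearly balance.\<close>

lemma abs_esym_le_power:
  assumes "finite A" "\<And>j. j \<in> A \<Longrightarrow> (y j)\<^sup>2 = 1"
    and T: "\<bar>\<Sum>j\<in>A. y j\<bar> \<le> T" "real (card A) \<le> T\<^sup>2"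
  shows "\<bar>esym y A k\<bar> \<le> T ^ k"
proof (induction k rule: less_induct)
  case (less k)
  consider "k = 0" | "k = 1" | l where "k = l + 2"
    by (metis One_nat_def Suc_1 add_2_eq_Suc' not0_implies_Suc)
  then show ?case
  proof cases
    case (3 l)
    have T0: "0 \<le> T" using T(1) by linarith
    have IH: "\<bar>esym y A (l + 1)\<bar> \<le> T ^ (l + 1)" "\<bar>esym y A l\<bar> \<le> T ^ l"
      using less[of "l + 1"] less[of l] 3 by simp_all
    have "real (l + 2) * \<bar>esym y A (l + 2)\<bar> \<le> T * T ^ (l + 1) + T\<^sup>2 * T ^ l"
      by (rule order.trans[OF abs_esym_recurrence[OF assms(1,2)]])
        (use IH T T0 in \<open>auto intro!: add_mono mult_mono\<close>)
    also have "\<dots> = 2 * T ^ (l + 2)" by (simp add: power2_eq_square)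
    also have "\<dots> \<le> real (l + 2) * T ^ (l + 2)"
      using T0 by (intro mult_right_mono) auto
    finally show ?thesis using 3 by simp
  qed (use T assms in \<open>simp_all add: esym_0 esym_1\<close>)
qed

text \<open>\<open>C\<close> depends on \<open>k\<close> only. After scaling by factorials the first
  term of the recurrence reproduces the main power, while the second is one order of
  \<open>card A\<close> smaller. Writing the error as a real quotient avoids the exponent
  \<open>k - 1\<close> at \<open>k = 0\<close>.\<close>

lemma fact_abs_esym_le:
  "\<exists>C\<ge>0. \<forall>(A :: 'a set) y. finite A \<longrightarrow> A \<noteq> {} \<longrightarrow> (\<forall>j\<in>A. (y j)\<^sup>2 = 1) \<longrightarrow>
    fact k * \<bar>esym y A k\<bar> \<le> \<bar>\<Sum>j\<in>A. y j\<bar> ^ k + C * real (card A) ^ k / real (card A)"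
proof (induction k rule: less_induct)
  case (less k)
  consider "k = 0" | "k = 1" | l where "k = l + 2"
    by (metis One_nat_def Suc_1 add_2_eq_Suc' not0_implies_Suc)
  then show ?case
  proof cases
    case (3 l)
    obtain C0 where C0: "C0 \<ge> 0" "\<And>(A :: 'a set) y. finite A \<Longrightarrow> A \<noteq> {} \<Longrightarrow> (\<forall>j\<in>A. (y j)\<^sup>2 = 1) \<Longrightarrow>
      fact l * \<bar>esym y A l\<bar> \<le> \<bar>\<Sum>j\<in>A. y j\<bar> ^ l + C0 * real (card A) ^ l / real (card A)"
      using less[of l] 3 by auto
    obtain C1 where C1: "C1 \<ge> 0" "\<And>(A :: 'a set) y. finite A \<Longrightarrow> A \<noteq> {} \<Longrightarrow> (\<forall>j\<in>A. (y j)\<^sup>2 = 1) \<Longrightarrow>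
      fact (l + 1) * \<bar>esym y A (l + 1)\<bar> \<le>
        \<bar>\<Sum>j\<in>A. y j\<bar> ^ (l + 1) + C1 * real (card A) ^ (l + 1) / real (card A)"
      using less[of "l + 1"] 3 by auto
    show ?thesis
    \<comment> \<open>\<open>C1\<close> is the error inherited from degree \<open>l + 1\<close>; the
      term of degree \<open>l\<close> enters with factor \<open>l + 1\<close>, and both its main
      part and its error are of lower order.\<close>
    proof (intro exI[of _ "C1 + real (l + 1) * (1 + C0)"] conjI allI impI)
      show "0 \<le> C1 + real (l + 1) * (1 + C0)" using C0 C1 by simp
    next
      fix A :: "'a set" and y :: "'a \<Rightarrow> real"
      assume A: "finite A" "A \<noteq> {}" and sq: "\<forall>j\<in>A. (y j)\<^sup>2 = 1"
      define D n where "D = \<bar>\<Sum>j\<in>A. y j\<bar>" and "n = real (card A)"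
      have n: "n \<ge> 1" using A by (simp add: n_def Suc_le_eq card_gt_0_iff)
      have "\<bar>y j\<bar> \<le> 1" if "j \<in> A" for j
        using sq that by (simp add: abs_square_eq_1)
      then have "D \<le> (\<Sum>j\<in>A. 1)"
        unfolding D_def by (intro order.trans[OF sum_abs] sum_mono) auto
      then have D: "0 \<le> D" "D \<le> n" by (auto simp: D_def n_def)
      have B0: "fact l * \<bar>esym y A l\<bar> \<le> D ^ l + C0 * n ^ l / n"
        and B1: "fact (l + 1) * \<bar>esym y A (l + 1)\<bar> \<le> D ^ (l + 1) + C1 * n ^ (l + 1) / n"
        using C0(2)[OF A sq] C1(2)[OF A sq] by (auto simp: D_def n_def)
      have "fact (l + 2) * \<bar>esym y A (l + 2)\<bar>
        = fact (l + 1) * (real (l + 2) * \<bar>esym y A (l + 2)\<bar>)"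
        by (simp add: algebra_simps)
      also have "\<dots> \<le> fact (l + 1) * (D * \<bar>esym y A (l + 1)\<bar> + n * \<bar>esym y A l\<bar>)"
        unfolding D_def n_def using A sq by (intro mult_left_mono abs_esym_recurrence) auto
      also have "\<dots> = D * (fact (l + 1) * \<bar>esym y A (l + 1)\<bar>)
          + real (l + 1) * n * (fact l * \<bar>esym y A l\<bar>)"
        by (simp add: algebra_simps)
      also have "\<dots> \<le> D * (D ^ (l + 1) + C1 * n ^ (l + 1) / n)
          + real (l + 1) * n * (D ^ l + C0 * n ^ l / n)"
        using B0 B1 D n by (intro add_mono mult_left_mono) auto
      also have "\<dots> = D ^ (l + 2) + C1 * (D * n ^ l) + real (l + 1) * (n * D ^ l + C0 * n ^ l)"
        using n by (simp add: field_simps)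
      also have "\<dots> \<le> D ^ (l + 2) + C1 * (n * n ^ l) + real (l + 1) * (n * n ^ l + C0 * (n * n ^ l))"
        using D n C0(1) C1(1) mult_right_mono[of 1 n "n ^ l"]
        by (intro add_mono mult_left_mono mult_right_mono power_mono) auto
      also have "\<dots> = D ^ (l + 2) + (C1 + real (l + 1) * (1 + C0)) * n ^ (l + 2) / n"
        using n by (simp add: field_simps)
      finally show "fact k * \<bar>esym y A k\<bar> \<le> \<bar>\<Sum>j\<in>A. y j\<bar> ^ k +
          (C1 + real (l + 1) * (1 + C0)) * real (card A) ^ k / real (card A)"
        using 3 by (simp add: D_def n_def)
    qed
  qed (auto intro!: exI[of _ 1] simp: esym_0 esym_1)
qed

text \<open>The product \<open>fact k * (n choose k)\<close> is the falling factorial. Each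
  induction step replaces a factor \<open>n\<close> by \<open>n - k\<close>, which loses at most
  \<open>k * n ^ k\<close>. The bound includes \<open>n < k\<close>, where the binomial coefficient
  vanishes.\<close>

lemma power_le_fact_binomial:
  "\<exists>C\<ge>0. \<forall>n>0. real n ^ k \<le> fact k * real (n choose k) + C * real n ^ k / real n"
proof (induction k)
  case (Suc k)
  then obtain C where C: "C \<ge> 0"
    "\<And>n. n > 0 \<Longrightarrow> real n ^ k \<le> fact k * real (n choose k) + C * real n ^ k / real n"
    by blast
  show ?case
  proof (intro exI[of _ "C + real k"] conjI allI impI)
    fix n :: nat assume n: "n > 0"
    have "real (fact k * (n choose k)) \<le> real (n ^ k)"
      using binomial_fact_pow[of n k] by (subst of_nat_le_iff) (simp add: mult.commute)
    then have le: "fact k * real (n choose k) \<le> real n ^ k" by simp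
    have step: "fact (Suc k) * real (n choose Suc k) = (real n - real k) * (fact k * real (n choose k))"
    proof -
      have "real (Suc k * (n choose Suc k)) = real ((n - k) * (n choose k))"
        by (metis binomial_absorption binomial_absorb_comp)
      also have "\<dots> = (real n - real k) * real (n choose k)"
        by (cases "k \<le> n") (auto simp: of_nat_diff)
      finally have eq: "real (Suc k) * real (n choose Suc k) = (real n - real k) * real (n choose k)"
        unfolding of_nat_mult .
      have "fact (Suc k) * real (n choose Suc k) = fact k * (real (Suc k) * real (n choose Suc k))"
        by simp
      then show ?thesis unfolding eq by simp
    qed
    have "real n ^ Suc k \<le> real n * (fact k * real (n choose k) + C * real n ^ k / real n)"
      using C(2)[OF n] by (simp add: mult_left_mono)
    also have "\<dots> = fact (Suc k) * real (n choose Suc k) + real k * (fact k * real (n choose k)) + C * real n ^ k"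
      unfolding step using n by (simp add: field_simps)
    also have "\<dots> \<le> fact (Suc k) * real (n choose Suc k) + real k * real n ^ k + C * real n ^ k"
      using le by (simp add: mult_left_mono)
    also have "\<dots> = fact (Suc k) * real (n choose Suc k) + (C + real k) * real n ^ Suc k / real n"
      using n by (simp add: field_simps)
    finally show "real n ^ Suc k \<le> fact (Suc k) * real (n choose Suc k) + (C + real k) * real n ^ Suc k / real n" .
  qed (use C in auto)
qed (auto intro: exI[of _ 0])

subsection \<open>Fourier expansion of the expectation\<close>

text \<open>The product of \<open>chi U\<close> over a set \<open>S\<close> is -1 to the power of
  the size of the intersection of \<open>S\<close> and \<open>U\<close>: the character indexed by
  \<open>U\<close>, evaluated at the indicator vector of \<open>S\<close>.\<close>

definition chi :: "nat set \<Rightarrow> nat \<Rightarrow> real" where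
  "chi U j = (if j \<in> U then -1 else 1)"

definition row_supp :: "bit mat \<Rightarrow> nat \<Rightarrow> nat \<Rightarrow> nat set" where
  "row_supp A n i = {j. j < n \<and> A $$ (i, j) = 1}"

lemma chi_square: "(chi U j)\<^sup>2 = 1"
  by (simp add: chi_def)

lemma sum_chi:
  assumes "U \<subseteq> {..<n}"
  shows "(\<Sum>j<n. chi U j) = real n - 2 * real (card U)"
proof -
  have "(\<Sum>j<n. chi U j) = (\<Sum>j<n. 1 - 2 * (if j \<in> U then 1 else 0))"
    by (intro sum.cong) (auto simp: chi_def)
  also have "\<dots> = real n - 2 * (\<Sum>j<n. if j \<in> U then 1 else 0)"
    by (simp add: sum_subtractf sum_distrib_left)
  also have "(\<Sum>j<n. if j \<in> U then 1 else 0) = real (card U)"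
    using assms by (simp add: sum.If_cases Int_absorb1)
  finally show ?thesis .
qed

definition bit_sign :: "bit \<Rightarrow> real" where
  "bit_sign b = (if b = 1 then -1 else 1)"

lemma bit_sign_sum: "bit_sign (\<Sum>i\<in>V. b i) = (\<Prod>i\<in>V. bit_sign (b i))"
proof (induction V rule: infinite_finite_induct)
  case (insert i V)
  have "bit_sign (a + c) = bit_sign a * bit_sign c" for a c
    by (cases a; cases c) (simp_all add: bit_sign_def)
  then show ?case using insert by simp
qed (simp_all add: bit_sign_def)

text \<open>A vector over GF(2) is determined by its support, and the transpose of \<open>A\<close>
  applied to it is the sum of the rows of \<open>A\<close> selected by that support. Hence
  \<open>Y\<close> counts the sets of rows that sum to zero.\<close>

lemma kernel_bij:
  fixes A :: "bit mat"
  assumes "A \<in> carrier_mat L n"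
  shows "bij_betw (\<lambda>v. {i. i < L \<and> vec_index v i = 1}) (mat_kernel (transpose_mat A))
    {V. V \<subseteq> {..<L} \<and> (\<forall>j<n. (\<Sum>i\<in>V. A $$ (i, j)) = 0)}"
proof -
  have b: "(if x = 1 then 1 else 0) = (x :: bit)" for x by (cases x) auto
  have iff: "v \<in> mat_kernel (transpose_mat A) \<longleftrightarrow>
      (\<forall>j<n. (\<Sum>i\<in>{i. i < L \<and> vec_index v i = 1}. A $$ (i, j)) = 0)"
    if v: "v \<in> carrier_vec L" for v :: "bit vec"
  proof -
    have "vec_index (transpose_mat A *\<^sub>v v) j = (\<Sum>i\<in>{i. i < L \<and> vec_index v i = 1}. A $$ (i, j))" if "j < n" for j
    proof -
      have "vec_index (transpose_mat A *\<^sub>v v) j = (\<Sum>i<L. A $$ (i, j) * vec_index v i)"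
        using assms v that by (auto simp: scalar_prod_def lessThan_atLeast0 intro!: sum.cong)
      also have "\<dots> = (\<Sum>i<L. if vec_index v i = 1 then A $$ (i, j) else 0)"
        by (intro sum.cong) auto
      also have "\<dots> = (\<Sum>i\<in>{i. i < L \<and> vec_index v i = 1}. A $$ (i, j))"
        by (subst sum.inter_filter[symmetric]) (auto intro!: sum.cong)
      finally show ?thesis .
    qed
    moreover have "dim_vec (transpose_mat A *\<^sub>v v) = n" using assms by simp
    ultimately show ?thesis
      using assms v by (auto simp: mat_kernel_def vec_eq_iff)
  qed
  have carr: "mat_kernel (transpose_mat A) \<subseteq> carrier_vec L"
    using assms by (auto simp: mat_kernel_def)
  show ?thesis
  proof (rule bij_betw_byWitness[where f' = "\<lambda>V. vec L (\<lambda>i. if i \<in> V then 1 else 0)"])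
    show "\<forall>v\<in>mat_kernel (transpose_mat A).
        vec L (\<lambda>i. if i \<in> {i. i < L \<and> vec_index v i = 1} then 1 else 0) = v"
      using carr by (auto intro!: eq_vecI simp: b)
    have *: "{i. i < L \<and> vec_index (vec L (\<lambda>i. if i \<in> V then 1 else (0 :: bit))) i = 1} = V"
      if "V \<subseteq> {..<L}" for V using that by (auto split: if_splits)
    then show "\<forall>V\<in>{V. V \<subseteq> {..<L} \<and> (\<forall>j<n. (\<Sum>i\<in>V. A $$ (i, j)) = 0)}.
        {i. i < L \<and> vec_index (vec L (\<lambda>i. if i \<in> V then 1 else (0 :: bit))) i = 1} = V"
      by blast
    show "(\<lambda>v. {i. i < L \<and> vec_index v i = 1}) ` mat_kernel (transpose_mat A)
        \<subseteq> {V. V \<subseteq> {..<L} \<and> (\<forall>j<n. (\<Sum>i\<in>V. A $$ (i, j)) = 0)}"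
      using iff carr by blast
    show "(\<lambda>V. vec L (\<lambda>i. if i \<in> V then 1 else 0)) `
        {V. V \<subseteq> {..<L} \<and> (\<forall>j<n. (\<Sum>i\<in>V. A $$ (i, j)) = 0)} \<subseteq> mat_kernel (transpose_mat A)"
    proof safe
      fix V assume "V \<subseteq> {..<L}" "\<forall>j<n. (\<Sum>i\<in>V. A $$ (i, j)) = 0"
      then show "vec L (\<lambda>i. if i \<in> V then 1 else 0) \<in> mat_kernel (transpose_mat A)"
        by (subst iff) (simp_all only: *, simp_all)
    qed
  qed
qed

lemma Y_eq_card:
  assumes "A \<in> carrier_mat L n"
  shows "Y A = card {V. V \<subseteq> {..<L} \<and> (\<forall>j<n. (\<Sum>i\<in>V. A $$ (i, j)) = 0)}"
  unfolding Y_def using kernel_bij[OF assms] by (rule bij_betw_same_card)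

lemma Y_ge_1:
  assumes "A \<in> carrier_mat L n"
  shows "Y A \<ge> 1"
proof -
  let ?K = "{V. V \<subseteq> {..<L} \<and> (\<forall>j<n. (\<Sum>i\<in>V. A $$ (i, j)) = 0)}"
  have "card {{} :: nat set} \<le> card ?K" by (rule card_mono) auto
  then show ?thesis unfolding Y_eq_card[OF assms] by simp
qed

text \<open>Both sides are -1 to the power of the number of ones that row \<open>i\<close> has in
  \<open>U\<close>. The right-hand side no longer mentions matrix entries, only the support of the
  row.\<close>

lemma prod_bit_sign_row:
  "(\<Prod>j\<in>U. bit_sign (A $$ (i, j))) = (\<Prod>j\<in>row_supp A n i. chi U j)" if U: "U \<subseteq> {..<n}"
proof -
  have "(\<Prod>j\<in>U. bit_sign (A $$ (i, j))) = (\<Prod>j\<in>U \<inter> {j. A $$ (i, j) = 1}. -1)"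
    using U by (subst prod.inter_restrict) (auto simp: bit_sign_def finite_subset[of _ "{..<n}"])
  also have "U \<inter> {j. A $$ (i, j) = 1} = row_supp A n i \<inter> U"
    using U by (auto simp: row_supp_def)
  also have "(\<Prod>j\<in>row_supp A n i \<inter> U. -1) = (\<Prod>j\<in>row_supp A n i. chi U j)"
    by (subst prod.inter_restrict) (auto simp: chi_def row_supp_def)
  finally show ?thesis .
qed

text \<open>A column sum vanishes or not according to whether \<open>(bit_sign s + 1) / 2\<close> is
  1 or 0. Multiplying these factors over the columns and expanding gives one summand for each set
  \<open>U\<close> of columns.\<close>

lemma Y_fourier:
  assumes A: "A \<in> carrier_mat L n"
  shows "real (Y A) = (\<Sum>U\<in>Pow {..<n}. \<Prod>i<L. 1 + (\<Prod>j\<in>row_supp A n i. chi U j)) / 2 ^ n"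
proof -
  define P where "P V = (\<forall>j<n. (\<Sum>i\<in>V. A $$ (i, j)) = 0)" for V
  have ind: "(if P V then 1 else 0) = (\<Sum>U\<in>Pow {..<n}. \<Prod>i\<in>V. \<Prod>j\<in>U. bit_sign (A $$ (i, j))) / 2 ^ n"
    for V
  proof -
    have "(if P V then 1 else 0) = (\<Prod>j<n. (bit_sign (\<Sum>i\<in>V. A $$ (i, j)) + 1) / 2)"
    proof (cases "P V")
      case True
      then show ?thesis by (simp add: P_def bit_sign_def)
    next
      case False
      then obtain j where "j < n" "(\<Sum>i\<in>V. A $$ (i, j)) \<noteq> 0" by (auto simp: P_def)
      then have "\<exists>j\<in>{..<n}. (bit_sign (\<Sum>i\<in>V. A $$ (i, j)) + 1) / 2 = 0"
        by (intro bexI[of _ j]) (auto simp: bit_sign_def)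
      then show ?thesis using False by (subst prod_zero) auto
    qed
    also have "\<dots> = (\<Prod>j<n. bit_sign (\<Sum>i\<in>V. A $$ (i, j)) + 1) / 2 ^ n"
      by (simp add: prod_dividef)
    also have "(\<Prod>j<n. bit_sign (\<Sum>i\<in>V. A $$ (i, j)) + 1)
        = (\<Sum>U\<in>Pow {..<n}. \<Prod>j\<in>U. \<Prod>i\<in>V. bit_sign (A $$ (i, j)))"
      by (simp add: prod_add bit_sign_sum)
    also have "\<dots> = (\<Sum>U\<in>Pow {..<n}. \<Prod>i\<in>V. \<Prod>j\<in>U. bit_sign (A $$ (i, j)))"
      by (intro sum.cong refl prod.swap)
    finally show ?thesis .
  qed
  have "real (Y A) = real (card {V \<in> Pow {..<L}. P V})"
    unfolding Y_eq_card[OF A] P_def by (simp add: Pow_def)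
  also have "\<dots> = (\<Sum>V\<in>Pow {..<L}. if P V then 1 else 0)"
    by (simp add: sum.If_cases Int_def)
  also have "\<dots> = (\<Sum>V\<in>Pow {..<L}. \<Sum>U\<in>Pow {..<n}. \<Prod>i\<in>V. \<Prod>j\<in>U. bit_sign (A $$ (i, j))) / 2 ^ n"
    unfolding ind by (simp add: sum_divide_distrib)
  also have "(\<Sum>V\<in>Pow {..<L}. \<Sum>U\<in>Pow {..<n}. \<Prod>i\<in>V. \<Prod>j\<in>U. bit_sign (A $$ (i, j)))
      = (\<Sum>U\<in>Pow {..<n}. \<Sum>V\<in>Pow {..<L}. \<Prod>i\<in>V. \<Prod>j\<in>U. bit_sign (A $$ (i, j)))"
    by (rule sum.swap)
  \<comment> \<open>The sum over sets \<open>V\<close> of rows is the expansion of a product over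
    rows, so each row now enters through a factor of its own.\<close>
  also have "\<dots> = (\<Sum>U\<in>Pow {..<n}. \<Prod>i<L. 1 + (\<Prod>j\<in>U. bit_sign (A $$ (i, j))))"
    by (simp add: prod_add add.commute[of 1])
  also have "\<dots> = (\<Sum>U\<in>Pow {..<n}. \<Prod>i<L. 1 + (\<Prod>j\<in>row_supp A n i. chi U j))"
    by (intro sum.cong prod.cong arg_cong2[of _ _ _ _ "(+)"] refl prod_bit_sign_row) auto
  finally show ?thesis .
qed

text \<open>A uniform matrix in \<open>M L n k\<close> amounts to an independent uniform choice of a
  \<open>k\<close>-set for every row. The restriction to \<open>{..<L}\<close> makes the choice
  function extensional, as \<open>PiE\<close> requires.\<close>

lemma M_bij:
  "bij_betw (\<lambda>A. \<lambda>i\<in>{..<L}. row_supp A n i) (M L n k)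
    ({..<L} \<rightarrow>\<^sub>E {S. S \<subseteq> {..<n} \<and> card S = k})"
proof (rule bij_betw_byWitness[where f' = "\<lambda>F. mat L n (\<lambda>(i, j). if j \<in> F i then 1 else 0)"])
  have b: "(if x = 1 then 1 else 0) = (x :: bit)" for x by (cases x) auto
  show "\<forall>A\<in>M L n k. mat L n (\<lambda>(i, j). if j \<in> (\<lambda>i\<in>{..<L}. row_supp A n i) i then 1 else 0) = A"
    by (auto simp: M_def row_supp_def b intro!: eq_matI)
  have rs: "row_supp (mat L n (\<lambda>(i, j). if j \<in> F i then 1 else 0)) n i = F i"
    if "F i \<subseteq> {..<n}" "i < L" for F i
    using that by (auto simp: row_supp_def split: if_splits)
  have F: "F i \<subseteq> {..<n}" "card (F i) = k"
    if "F \<in> {..<L} \<rightarrow>\<^sub>E {S. S \<subseteq> {..<n} \<and> card S = k}" "i < L" for F i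
    using that by (auto dest: PiE_mem)
  show "\<forall>F\<in>{..<L} \<rightarrow>\<^sub>E {S. S \<subseteq> {..<n} \<and> card S = k}.
      (\<lambda>i\<in>{..<L}. row_supp (mat L n (\<lambda>(i, j). if j \<in> F i then 1 else 0)) n i) = F"
  proof
    fix F assume Fin: "F \<in> {..<L} \<rightarrow>\<^sub>E {S. S \<subseteq> {..<n} \<and> card S = k}"
    show "(\<lambda>i\<in>{..<L}. row_supp (mat L n (\<lambda>(i, j). if j \<in> F i then 1 else 0)) n i) = F"
      using rs F[OF Fin] Fin by (intro extensionalityI[of _ "{..<L}"]) (auto simp: PiE_def)
  qed
  show "(\<lambda>A. \<lambda>i\<in>{..<L}. row_supp A n i) ` M L n k \<subseteq> {..<L} \<rightarrow>\<^sub>E {S. S \<subseteq> {..<n} \<and> card S = k}"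
    by (auto simp: M_def row_supp_def)
  show "(\<lambda>F. mat L n (\<lambda>(i, j). if j \<in> F i then 1 else 0)) `
      ({..<L} \<rightarrow>\<^sub>E {S. S \<subseteq> {..<n} \<and> card S = k}) \<subseteq> M L n k"
  proof safe
    fix F assume Fin: "F \<in> {..<L} \<rightarrow>\<^sub>E {S. S \<subseteq> {..<n} \<and> card S = k}"
    show "mat L n (\<lambda>(i, j). if j \<in> F i then 1 else 0) \<in> M L n k"
      using rs F[OF Fin] unfolding M_def row_supp_def by simp
  qed
qed

text \<open>Since the rows are independent and identically distributed, averaging the product over
  rows gives an \<open>L\<close>-th power, whose base is the average over all
  \<open>k\<close>-sets.\<close>

lemma expected_Y_fourier:
  assumes "k \<le> n"
  shows "expected_Y L n k =
    (\<Sum>U\<in>Pow {..<n}. (1 + esym (chi U) {..<n} k / real (n choose k)) ^ L) / 2 ^ n"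
proof -
  let ?S = "{S. S \<subseteq> {..<n} \<and> card S = k}"
  define N where "N = real (n choose k)"
  have N: "N > 0" using assms by (simp add: N_def zero_less_binomial)
  have cS: "card ?S = n choose k" using n_subsets[of "{..<n}" k] by simp
  have finS: "finite ?S" by simp
  have cM: "real (card (M L n k)) = N ^ L"
    using bij_betw_same_card[OF M_bij, of L n k] cS by (simp add: card_PiE N_def)
  have row: "(\<Sum>A\<in>M L n k. \<Prod>i<L. 1 + (\<Prod>j\<in>row_supp A n i. chi U j))
      = (N + esym (chi U) {..<n} k) ^ L" for U
  proof -
    have "(\<Sum>A\<in>M L n k. \<Prod>i<L. 1 + (\<Prod>j\<in>row_supp A n i. chi U j))
        = (\<Sum>A\<in>M L n k. \<Prod>i<L. 1 + (\<Prod>j\<in>(\<lambda>i\<in>{..<L}. row_supp A n i) i. chi U j))"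
      by simp
    also have "\<dots> = (\<Sum>F\<in>{..<L} \<rightarrow>\<^sub>E ?S. \<Prod>i<L. 1 + (\<Prod>j\<in>F i. chi U j))"
      by (rule sum.reindex_bij_betw[OF M_bij])
    also have "\<dots> = (\<Prod>i<L. \<Sum>S\<in>?S. 1 + (\<Prod>j\<in>S. chi U j))"
      by (rule prod_sum_PiE[symmetric]) (simp_all add: finS)
    also have "(\<Sum>S\<in>?S. 1 + (\<Prod>j\<in>S. chi U j)) = N + esym (chi U) {..<n} k"
      by (simp add: sum.distrib cS N_def esym_def)
    finally show ?thesis by simp
  qed
  have "(\<Sum>A\<in>M L n k. real (Y A)) =
      (\<Sum>A\<in>M L n k. \<Sum>U\<in>Pow {..<n}. \<Prod>i<L. 1 + (\<Prod>j\<in>row_supp A n i. chi U j)) / 2 ^ n"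
    unfolding sum_divide_distrib
    by (intro sum.cong refl) (simp add: Y_fourier[of _ L n] M_def sum_divide_distrib)
  also have "(\<Sum>A\<in>M L n k. \<Sum>U\<in>Pow {..<n}. \<Prod>i<L. 1 + (\<Prod>j\<in>row_supp A n i. chi U j))
      = (\<Sum>U\<in>Pow {..<n}. (N + esym (chi U) {..<n} k) ^ L)"
    by (subst sum.swap) (simp add: row)
  finally have "expected_Y L n k = (\<Sum>U\<in>Pow {..<n}. (N + esym (chi U) {..<n} k) ^ L) / 2 ^ n / N ^ L"
    unfolding expected_Y_def by (simp add: integral_pmf_of_set finite_M M_nonempty[OF assms] cM)
  also have "\<dots> = (\<Sum>U\<in>Pow {..<n}. ((N + esym (chi U) {..<n} k) / N) ^ L) / 2 ^ n"
    by (simp add: sum_divide_distrib power_divide mult.commute)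
  also have "(\<lambda>U. (N + esym (chi U) {..<n} k) / N) = (\<lambda>U. 1 + esym (chi U) {..<n} k / N)"
    using N by (simp add: add_divide_distrib)
  finally show ?thesis unfolding N_def .
qed

lemma expected_Y_ge_1:
  assumes "k \<le> n"
  shows "expected_Y L n k \<ge> 1"
proof -
  have "real (card (M L n k)) \<le> (\<Sum>A\<in>M L n k. real (Y A))"
    using sum_mono[of "M L n k" "\<lambda>_. 1" "\<lambda>A. real (Y A)"] Y_ge_1 by (force simp: M_def)
  then show ?thesis
    unfolding expected_Y_def using finite_M M_nonempty[OF assms]
    by (simp add: integral_pmf_of_set card_gt_0_iff divide_simps)
qed

subsection \<open>Entropy estimates\<close>

text \<open>The inequality \<open>ln z <= z - 1\<close> is used at \<open>z = 1 / sqrt y\<close>.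
  Unlike the tangent line at \<open>y = 1\<close>, this bound keeps a positive quadratic term there,
  which \<open>H_ge\<close> relies on.\<close>

lemma mult_ln_ge:
  fixes y :: real
  assumes "y \<ge> 0"
  shows "y * ln y \<ge> 2 * (y - sqrt y)"
proof (cases "y = 0")
  case False
  with assms have y: "y > 0" by simp
  have "- ln (sqrt y) \<le> 1 / sqrt y - 1"
    using ln_le_minus_one[of "1 / sqrt y"] y by (simp add: ln_div)
  then have "ln y \<ge> 2 * (1 - 1 / sqrt y)"
    using y by (simp add: ln_sqrt)
  then have "y * ln y \<ge> y * (2 * (1 - 1 / sqrt y))"
    using y by (intro mult_left_mono) auto
  also have "y * (2 * (1 - 1 / sqrt y)) = 2 * (y - y / sqrt y)" by (simp add: algebra_simps)
  finally show ?thesis using y by (simp add: real_div_sqrt)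
qed simp

text \<open>A Pinsker-type inequality: \<open>ln 2 + H x\<close> is the relative entropy of
  \<open>(x, 1 - x)\<close> with respect to the fair coin. It is bounded below by the squared
  Hellinger-type distance \<open>2 - s\<close>, which is then compared with
  \<open>(1 - 2 * x)^2\<close>.\<close>

lemma H_ge:
  assumes "0 \<le> x" "x \<le> 1"
  shows "ln 2 + H x \<ge> (1 - 2 * x)\<^sup>2 / 4"
proof -
  define a b s where "a = sqrt (2 * x)" and "b = sqrt (2 * (1 - x))" and "s = a + b"
  have ab: "a \<ge> 0" "b \<ge> 0" "a * a = 2 * x" "b * b = 2 * (1 - x)"
    using assms by (auto simp: a_def b_def)
  have ln2: "y * ln (2 * y) = y * ln 2 + y * ln y" if "y \<ge> 0" for y :: real
    using that by (cases "y = 0") (simp_all add: ln_mult algebra_simps)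
  have "2 * (ln 2 + H x) = 2 * x * ln (2 * x) + 2 * (1 - x) * ln (2 * (1 - x))"
    using ln2[of x] ln2[of "1 - x"] assms by (simp add: H_def algebra_simps)
  also have "\<dots> \<ge> 2 * (2 * x - a) + 2 * (2 * (1 - x) - b)"
    using assms unfolding a_def b_def by (intro add_mono mult_ln_ge) auto
  finally have G: "ln 2 + H x \<ge> 2 - s" by (simp add: s_def algebra_simps)
  \<comment> \<open>From \<open>a^2 + b^2 = 2\<close> one gets \<open>(b - a)^2 + s^2 = 4\<close>,
    and \<open>b^2 - a^2\<close> is \<open>2 * (1 - 2 * x)\<close>.\<close>
  have d: "4 * (1 - 2 * x)\<^sup>2 = (2 - s) * ((2 + s) * s\<^sup>2)"
  proof -
    have "2 * (1 - 2 * x) = (b - a) * s"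
      using ab by (simp add: s_def algebra_simps)
    then have "(2 * (1 - 2 * x))\<^sup>2 = (b - a)\<^sup>2 * s\<^sup>2" by (simp add: power_mult_distrib)
    moreover have "(b - a)\<^sup>2 = (2 - s) * (2 + s)"
      using ab by (simp add: s_def power2_eq_square algebra_simps)
    ultimately show ?thesis unfolding power_mult_distrib by (simp add: mult.assoc)
  qed
  have "s\<^sup>2 = 4 - (b - a)\<^sup>2"
    using ab by (simp add: s_def power2_eq_square algebra_simps)
  then have "s\<^sup>2 \<le> 2\<^sup>2" by simp
  then have s: "0 \<le> s" "s \<le> 2" using ab power2_le_imp_le[of s 2] by (auto simp: s_def)
  have "(2 - s) * ((2 + s) * s\<^sup>2) \<le> (2 - s) * (4 * 4)"
    using s \<open>s\<^sup>2 \<le> 2\<^sup>2\<close> by (intro mult_left_mono mult_mono) auto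
  then have "4 * (1 - 2 * x)\<^sup>2 \<le> (2 - s) * (4 * 4)" unfolding d .
  then have "(1 - 2 * x)\<^sup>2 / 4 \<le> 2 - s" by simp
  then show ?thesis using G by (rule order.trans)
qed

lemma H_le_0:
  assumes "0 \<le> x" "x \<le> 1"
  shows "H x \<le> 0"
proof -
  have "y * ln y \<le> 0" if "0 \<le> y" "y \<le> 1" for y :: real
    using that by (cases "y = 0") (auto intro: mult_nonneg_nonpos)
  from this[of x] this[of "1 - x"] show ?thesis
    using assms by (simp add: H_def)
qed

text \<open>The gap between \<open>c\<close> and \<open>t\<close> is what later yields exponential
  decay. Clearing the denominator gives an inequality that also holds at \<open>x = 1/2\<close>,
  where both sides vanish, and symmetry of \<open>H\<close> extends it to the whole unit
  interval.\<close>

lemma theta_strict_bound: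
  assumes "k \<ge> 1" "ereal c < theta k"
  obtains t where "c < t" "\<And>x. 0 \<le> x \<Longrightarrow> x \<le> 1 \<Longrightarrow> t * ln (1 + \<bar>1 - 2 * x\<bar> ^ k) \<le> ln 2 + H x"
proof -
  obtain t where t: "ereal c < ereal t" "ereal t < theta k"
    using ereal_dense2[OF assms(2)] by blast
  have half: "t * ln (1 + \<bar>1 - 2 * x\<bar> ^ k) \<le> ln 2 + H x" if x: "0 \<le> x" "x \<le> 1/2" for x
  proof (cases "x = 1/2")
    case True
    then have "1 - 2 * x = 0" by simp
    then show ?thesis using H_ge[of x] assms x by (simp add: power_0_left)
  next
    case False
    with x have pos: "0 < (1 - 2 * x) ^ k" by auto
    then have "0 < ln (1 + (1 - 2 * x) ^ k)" by simp
    moreover have "ereal t \<le> f k x"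
      using t(2) x unfolding theta_def by (intro order.trans[OF less_imp_le INF_lower]) auto
    ultimately show ?thesis using False x
      by (simp add: f_def field_simps)
  qed
  show thesis
  proof (rule that)
    show "c < t" using t by simp
    show "t * ln (1 + \<bar>1 - 2 * x\<bar> ^ k) \<le> ln 2 + H x" if "0 \<le> x" "x \<le> 1" for x
    proof (cases "x \<le> 1/2")
      case False
      have "H (1 - x) = H x" by (simp add: H_def)
      moreover have "\<bar>1 - 2 * (1 - x)\<bar> = \<bar>1 - 2 * x\<bar>" by (simp add: abs_if)
      ultimately show ?thesis using half[of "1 - x"] False that by simp
    qed (use half that in auto)
  qed
qed

text \<open>With \<open>x = m / n\<close>, the summand of index \<open>m\<close> in the expansion of
  \<open>(x + (1 - x)) ^ n = 1\<close> is at most 1. The cases \<open>m = 0\<close> and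
  \<open>m = n\<close> are separate because \<open>exp (ln 0)\<close> is not 0.\<close>

lemma binomial_le_exp_H:
  assumes "m \<le> n" "n > 0"
  shows "real (n choose m) \<le> exp (- real n * H (real m / real n))"
proof -
  define x where "x = real m / real n"
  consider "m = 0" | "m = n" | "0 < m" "m < n" using assms by linarith
  then show ?thesis
  proof cases
    case 3
    have x: "0 < x" "x < 1" using 3 by (auto simp: x_def)
    have nx: "real n * x = real m" "real n * (1 - x) = real (n - m)"
      using assms by (auto simp: x_def field_simps of_nat_diff)
    have "exp (real n * H x) = exp (real m * ln x + real (n - m) * ln (1 - x))"
      unfolding nx[symmetric] by (simp add: H_def algebra_simps)
    also have "\<dots> = x ^ m * (1 - x) ^ (n - m)"
      using x by (simp add: exp_add exp_of_nat_mult)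
    finally have e: "exp (real n * H x) = x ^ m * (1 - x) ^ (n - m)" .
    have "real (n choose m) * exp (real n * H x) \<le> (\<Sum>i\<le>n. real (n choose i) * x ^ i * (1 - x) ^ (n - i))"
      unfolding e mult.assoc[symmetric]
      by (rule member_le_sum[of m]) (use assms x in auto)
    also have "\<dots> = (x + (1 - x)) ^ n" by (simp only: binomial_ring)
    finally show ?thesis by (simp add: exp_minus field_simps flip: x_def)
  qed (use assms in \<open>simp_all add: H_def\<close>)
qed

subsection \<open>Bounds on the Fourier terms\<close>

lemma esym_ratio_le:
  assumes "k \<ge> 1"
  obtains C where "C \<ge> 0" "\<And>n A y. n \<ge> k \<Longrightarrow> card A = n \<Longrightarrow> finite A \<Longrightarrow> (\<forall>j\<in>A. (y j)\<^sup>2 = 1) \<Longrightarrow>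
    \<bar>esym y (A :: 'a set) k / real (n choose k)\<bar> \<le> \<bar>(\<Sum>j\<in>A. y j) / real n\<bar> ^ k + C / real n"
proof -
  obtain C1 where C1: "C1 \<ge> 0" "\<And>(A :: 'a set) y. finite A \<Longrightarrow> A \<noteq> {} \<Longrightarrow> (\<forall>j\<in>A. (y j)\<^sup>2 = 1) \<Longrightarrow>
    fact k * \<bar>esym y A k\<bar> \<le> \<bar>\<Sum>j\<in>A. y j\<bar> ^ k + C1 * real (card A) ^ k / real (card A)"
    using fact_abs_esym_le[of k] by blast
  obtain C2 where C2: "C2 \<ge> 0"
    "\<And>n. n > 0 \<Longrightarrow> real n ^ k \<le> fact k * real (n choose k) + C2 * real n ^ k / real n"
    using power_le_fact_binomial[of k] by blast
  define B where "B = real k ^ k"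
  show thesis
  proof (rule that)
    show "(C2 + C1) * B \<ge> 0" using C1 C2 by (simp add: B_def)
    fix n :: nat and A :: "'a set" and y :: "'a \<Rightarrow> real"
    assume n: "n \<ge> k" "card A = n" and fin: "finite A" and sq: "\<forall>j\<in>A. (y j)\<^sup>2 = 1"
    have n0: "n > 0" using n assms by linarith
    then have ne: "A \<noteq> {}" using n by auto
    define F where "F = fact k * real (n choose k)"
    define d where "d = \<bar>(\<Sum>j\<in>A. y j) / real n\<bar>"
    have F: "F > 0" using n by (simp add: F_def zero_less_binomial)
    have dn: "\<bar>\<Sum>j\<in>A. y j\<bar> = d * real n" using n0 by (simp add: d_def)
    have "\<bar>y j\<bar> \<le> 1" if "j \<in> A" for j
      using sq that by (simp add: abs_square_eq_1)
    then have "\<bar>\<Sum>j\<in>A. y j\<bar> \<le> (\<Sum>j\<in>A. 1)"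
      by (intro order.trans[OF sum_abs] sum_mono) auto
    then have d: "0 \<le> d" "d \<le> 1" using n n0 by (auto simp: d_def)
    \<comment> \<open>This converts errors measured against \<open>n ^ k\<close> into errors
      relative to the denominator \<open>F\<close>, at the cost of the constant
      \<open>B\<close>.\<close>
    have "(real n / real k) ^ k \<le> real (n choose k)"
      using binomial_ge_n_over_k_pow_k[OF n(1), where 'a = real] by simp
    also have "\<dots> \<le> F" by (simp add: F_def mult_le_cancel_right1)
    finally have FB: "real n ^ k \<le> B * F"
      using assms by (simp add: B_def power_divide field_simps)
    have "fact k * \<bar>esym y A k\<bar> \<le> d ^ k * real n ^ k + C1 * real n ^ k / real n"
      using C1(2)[OF fin ne sq] n dn by (simp add: power_mult_distrib)
    also have "\<dots> \<le> d ^ k * (F + C2 * real n ^ k / real n) + C1 * real n ^ k / real n"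
      using C2(2)[OF n0] d by (intro add_mono mult_left_mono) (auto simp: F_def)
    also have "\<dots> \<le> d ^ k * F + 1 * (C2 * real n ^ k / real n) + C1 * real n ^ k / real n"
      unfolding distrib_left using d C2 F by (intro add_mono mult_right_mono power_le_one) auto
    also have "\<dots> = d ^ k * F + (C2 + C1) / real n * real n ^ k" by (simp add: distrib_right add_divide_distrib)
    also have "\<dots> \<le> d ^ k * F + (C2 + C1) / real n * (B * F)"
      using FB C1(1) C2(1) by (intro add_left_mono mult_left_mono) auto
    also have "\<dots> = (d ^ k + (C2 + C1) * B / real n) * F" by (simp add: field_simps)
    finally have "fact k * \<bar>esym y A k\<bar> / F \<le> d ^ k + (C2 + C1) * B / real n"
      using F by (simp add: pos_divide_le_eq)
    moreover have "fact k * \<bar>esym y A k\<bar> / F = \<bar>esym y A k / real (n choose k)\<bar>"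
      by (simp add: F_def abs_divide)
    ultimately show "\<bar>esym y A k / real (n choose k)\<bar>
        \<le> \<bar>(\<Sum>j\<in>A. y j) / real n\<bar> ^ k + (C2 + C1) * B / real n"
      by (simp add: d_def)
  qed
qed

text \<open>The base may be negative and \<open>L\<close> even, so monotonicity of powers is applied
  only after passing to absolute values.\<close>

lemma power_one_plus_le:
  fixes l :: real
  shows "(1 + l) ^ L \<le> (1 + \<bar>l\<bar>) ^ L"
proof -
  have "(1 + l) ^ L \<le> \<bar>1 + l\<bar> ^ L" by (simp add: power_abs[symmetric])
  also have "\<dots> \<le> (1 + \<bar>l\<bar>) ^ L" by (intro power_mono) auto
  finally show ?thesis .
qed

text \<open>The power is at most \<open>exp ((c / t) * n * G)\<close> up to a constant factor,
  against \<open>exp (- n * G)\<close> for the weight \<open>(n choose m) / 2 ^ n\<close>. Keeping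
  the binomial coefficient as a denominator makes the later sum over all sets of one size
  harmless.\<close>

lemma outer_term_le:
  assumes t: "0 < c" "c < t"
    and tH: "\<And>x. 0 \<le> x \<Longrightarrow> x \<le> 1 \<Longrightarrow> t * ln (1 + \<bar>1 - 2 * x\<bar> ^ k) \<le> ln 2 + H x"
    and n: "n > 0" "m \<le> n" and L: "real L \<le> c * real n + 1" and C: "C \<ge> 0"
    and l: "\<bar>l\<bar> \<le> \<bar>1 - 2 * (real m / real n)\<bar> ^ k + C / real n"
  shows "(1 + l) ^ L / 2 ^ n \<le>
    exp (1 / t + c * C + C - (1 - c / t) * (real n * (1 - 2 * (real m / real n))\<^sup>2 / 4)) / real (n choose m)"
proof -
  define x where "x = real m / real n"
  have x: "0 \<le> x" "x \<le> 1" using n by (auto simp: x_def)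
  define G where "G = ln 2 + H x"
  have "H x \<le> 0" "ln 2 \<le> (1 :: real)" using H_le_0[OF x] ln_le_minus_one[of "2 :: real"] by auto
  then have G: "(1 - 2 * x)\<^sup>2 / 4 \<le> G" "0 \<le> G" "G \<le> 1"
    using H_ge[OF x] order.trans[OF _ H_ge[OF x], of 0] by (auto simp: G_def)
  \<comment> \<open>The constant collects \<open>1 / t\<close> from the rounding of \<open>L\<close>
    together with \<open>G <= 1\<close>, \<open>c * C\<close> from the \<open>c * n\<close> copies
    of \<open>C / n\<close>, and \<open>C\<close> from rounding again.\<close>
  have Lx: "real L * (G / t + C / real n) \<le> c * real n * (G / t) + (1 / t + c * C + C)"
  proof -
    have "real L * (G / t + C / real n) \<le> (c * real n + 1) * (G / t + C / real n)"
      using L G t C by (intro mult_right_mono) auto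
    also have "\<dots> = c * real n * (G / t) + (G / t + c * C + C / real n)"
      using n by (simp add: algebra_simps)
    also have "\<dots> \<le> c * real n * (G / t) + (1 / t + c * C + C)"
    proof -
      have "C / real n \<le> C" using n C mult_left_mono[of 1 "real n" C] by (simp add: divide_le_eq)
      moreover have "G / t \<le> 1 / t" using G t by (simp add: divide_right_mono)
      ultimately show ?thesis by simp
    qed
    finally show ?thesis .
  qed
  have d0: "0 \<le> \<bar>1 - 2 * x\<bar> ^ k" by simp
  have "1 + \<bar>l\<bar> \<le> (1 + \<bar>1 - 2 * x\<bar> ^ k) * (1 + C / real n)"
  proof -
    have "0 \<le> \<bar>1 - 2 * x\<bar> ^ k * (C / real n)" using C by simp
    moreover have "\<bar>l\<bar> \<le> \<bar>1 - 2 * x\<bar> ^ k + C / real n" using l by (simp add: x_def)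
    ultimately show ?thesis by (simp only: distrib_left distrib_right mult_1 mult_1_right)
  qed
  also have "\<dots> \<le> exp (G / t) * exp (C / real n)"
  proof (rule mult_mono)
    have "ln (1 + \<bar>1 - 2 * x\<bar> ^ k) \<le> G / t"
      using tH[OF x] t by (simp add: G_def field_simps)
    then have "exp (ln (1 + \<bar>1 - 2 * x\<bar> ^ k)) \<le> exp (G / t)" by simp
    then show "1 + \<bar>1 - 2 * x\<bar> ^ k \<le> exp (G / t)"
      using d0 by (subst (asm) exp_ln) linarith+
  qed (use C in \<open>auto simp: exp_ge_add_one_self\<close>)
  finally have "1 + \<bar>l\<bar> \<le> exp (G / t + C / real n)" by (simp add: exp_add)
  then have "(1 + \<bar>l\<bar>) ^ L \<le> exp (G / t + C / real n) ^ L"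
    by (intro power_mono) auto
  also have "\<dots> = exp (real L * (G / t + C / real n))" by (simp add: exp_of_nat_mult)
  also have "\<dots> \<le> exp (c * real n * (G / t) + (1 / t + c * C + C))" using Lx by simp
  finally have pow: "(1 + l) ^ L \<le> exp (c * real n * (G / t) + (1 / t + c * C + C))"
    using power_one_plus_le[of l L] by linarith
  have bin: "real (n choose m) / 2 ^ n \<le> exp (- real n * G)"
  proof -
    have "exp (- real n * G) = exp (- real n * H x) * exp (- (real n * ln 2))"
      by (simp add: G_def algebra_simps flip: exp_add)
    also have "exp (- (real n * ln 2)) = 1 / 2 ^ n"
      by (simp add: exp_minus exp_of_nat_mult inverse_eq_divide)
    finally show ?thesis
      using binomial_le_exp_H[OF n(2,1)] by (simp add: divide_right_mono flip: x_def)
  qed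
  have "(1 + l) ^ L / 2 ^ n * real (n choose m) = (1 + l) ^ L * (real (n choose m) / 2 ^ n)" by simp
  also have "\<dots> \<le> exp (c * real n * (G / t) + (1 / t + c * C + C)) * exp (- real n * G)"
    using pow bin by (intro mult_mono) auto
  also have "\<dots> = exp (1 / t + c * C + C - (1 - c / t) * (real n * G))"
    by (simp add: algebra_simps flip: exp_add)
  also have "\<dots> \<le> exp (1 / t + c * C + C - (1 - c / t) * (real n * ((1 - 2 * x)\<^sup>2 / 4)))"
    using t G(1) by (simp add: mult_left_mono)
  finally show ?thesis
    using n by (simp add: pos_le_divide_eq zero_less_binomial x_def)
qed

text \<open>With \<open>q = k * T / n <= 1\<close>, the ratio is at most \<open>q ^ k\<close>, and
  \<open>k >= 3\<close> bounds this by \<open>q ^ 3\<close>, so the exponent is small once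
  \<open>n * q ^ 3\<close> is.\<close>

lemma central_term_le:
  assumes k: "k \<ge> 3" "k \<le> n" and T: "real k * T \<le> real n" "0 \<le> T"
    and L: "real L \<le> c * real n + 1" and l: "\<bar>l\<bar> \<le> T ^ k / real (n choose k)"
  shows "(1 + l) ^ L \<le> exp ((c * real n + 1) * (real k * T / real n) ^ 3)"
proof -
  define q where "q = real k * T / real n"
  have n: "real n > 0" "real k > 0" using k by auto
  have q: "0 \<le> q" "q \<le> 1" using T n by (auto simp: q_def)
  have "(real n / real k) ^ k \<le> real (n choose k)"
    using binomial_ge_n_over_k_pow_k[OF k(2), where 'a = real] by simp
  then have "T ^ k / real (n choose k) \<le> T ^ k / (real n / real k) ^ k"
    using T n by (intro divide_left_mono) (auto simp: zero_less_binomial k)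
  also have "\<dots> = q ^ k" using n by (simp add: q_def power_divide power_mult_distrib)
  also have "\<dots> \<le> q ^ 3" using q k by (intro power_decreasing) auto
  finally have l3: "\<bar>l\<bar> \<le> q ^ 3" using l by linarith
  have "(1 + l) ^ L \<le> (1 + \<bar>l\<bar>) ^ L" by (rule power_one_plus_le)
  also have "\<dots> \<le> exp (q ^ 3) ^ L"
    using l3 exp_ge_add_one_self[of "q ^ 3"] by (intro power_mono) linarith+
  also have "\<dots> = exp (real L * q ^ 3)" by (simp add: exp_of_nat_mult)
  also have "\<dots> \<le> exp ((c * real n + 1) * q ^ 3)"
    using L q by (simp add: mult_right_mono)
  finally show ?thesis by (simp add: q_def)
qed

section \<open>Summation over all subsets and passage to the limit\<close>

lemma sum_inverse_binomial_Pow: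
  "(\<Sum>U\<in>Pow {..<n}. 1 / real (n choose card U)) = real n + 1"
proof -
  have "(\<Sum>U\<in>Pow {..<n}. 1 / real (n choose card U))
      = (\<Sum>m\<le>n. \<Sum>U\<in>{U \<in> Pow {..<n}. card U = m}. 1 / real (n choose card U))"
    by (rule sum.group[symmetric]) (auto intro: card_mono[of "{..<n}", simplified])
  \<comment> \<open>Each of the \<open>n + 1\<close> possible sizes contributes exactly 1, so the
    outer terms will cost only a factor \<open>n + 1\<close>.\<close>
  also have "\<dots> = (\<Sum>m\<le>n. 1)"
  proof (rule sum.cong[OF refl])
    fix m assume "m \<in> {..n}"
    then show "(\<Sum>U\<in>{U \<in> Pow {..<n}. card U = m}. 1 / real (n choose card U)) = 1"
      using n_subsets[of "{..<n}" m] by (simp add: Pow_def zero_less_binomial)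
  qed
  finally show ?thesis by simp
qed

theorem theorem3:
  fixes k :: nat and c :: real and L :: "nat \<Rightarrow> nat"
  assumes "k \<ge> 3"
    and "0 < c" and "ereal c < theta k"
    and "\<And>n. L n \<in> {nat \<lfloor>c * real n\<rfloor>, nat \<lceil>c * real n\<rceil>}"
  shows "(\<lambda>n. expected_Y (L n) n k) \<longlonglongrightarrow> 1"
proof -
  have k1: "k \<ge> 1" and k0: "real k > 0" using assms(1) by simp_all
  obtain t where t: "c < t"
    "\<And>x. 0 \<le> x \<Longrightarrow> x \<le> 1 \<Longrightarrow> t * ln (1 + \<bar>1 - 2 * x\<bar> ^ k) \<le> ln 2 + H x"
    using theta_strict_bound[OF k1 assms(3)] by blast
  obtain C where C: "C \<ge> 0" "\<And>n A y. n \<ge> k \<Longrightarrow> card A = n \<Longrightarrow> finite A \<Longrightarrow> (\<forall>j\<in>A. (y j)\<^sup>2 = 1) \<Longrightarrow>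
    \<bar>esym y (A :: nat set) k / real (n choose k)\<bar> \<le> \<bar>(\<Sum>j\<in>A. y j) / real n\<bar> ^ k + C / real n"
    using esym_ratio_le[OF k1] by blast
  define K where "K = 1 / t + c * C + C"
  define \<epsilon> where "\<epsilon> = 1 - c / t"
  have \<epsilon>: "\<epsilon> > 0" using t(1) assms(2) by (simp add: \<epsilon>_def)
  \<comment> \<open>Any exponent strictly between 1/2 and 2/3 would serve: above 1/2 the decay of
    \<open>B n\<close> beats the factor \<open>n + 1\<close>, and below 2/3 the exponent in
    \<open>A n\<close> tends to 0.\<close>
  define T where "T n = real n powr (3/5)" for n
  define A where "A n = exp ((c * real n + 1) * (real k * T n / real n) ^ 3)" for n
  define B where "B n = exp (K - \<epsilon> * ((T n)\<^sup>2 / real n / 4))" for n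
  have L: "real (L n) \<le> c * real n + 1" for n
  proof -
    have "0 \<le> c * real n" using assms(2) by simp
    then show ?thesis using assms(4)[of n] by (auto simp: of_nat_nat) linarith+
  qed
  have upper: "expected_Y (L n) n k \<le> A n + B n * (real n + 1)"
    if n: "n \<ge> k" and kT: "real k * T n \<le> real n" for n
  proof -
    have n0: "n > 0" using n k1 by linarith
    have T0: "T n > 0" using n0 by (simp add: T_def)
    have T2: "real n \<le> (T n)\<^sup>2"
    proof -
      have "real n powr 1 \<le> real n powr (6/5)" using n0 by (intro powr_mono) auto
      then show ?thesis using n0 by (simp add: T_def power2_eq_square flip: powr_add)
    qed
    \<comment> \<open>Adding the central and the outer bound gives one estimate valid for every
      \<open>U\<close>, so the sum need not be split. The first part sums to \<open>A n\<close>, as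
      there are \<open>2 ^ n\<close> sets.\<close>
    have "(1 + esym (chi U) {..<n} k / real (n choose k)) ^ L n / 2 ^ n
        \<le> A n / 2 ^ n + B n * (1 / real (n choose card U))" if U: "U \<in> Pow {..<n}" for U
    proof -
      define m where "m = card U"
      define l where "l = esym (chi U) {..<n} k / real (n choose k)"
      have m: "m \<le> n" using U card_mono[of "{..<n}" U] by (simp add: m_def)
      have s: "(\<Sum>j<n. chi U j) = real n - 2 * real m"
        using U sum_chi by (simp add: m_def)
      have nonneg: "0 \<le> A n" "0 \<le> B n" by (simp_all add: A_def B_def)
      show ?thesis
      proof (cases "\<bar>real n - 2 * real m\<bar> \<le> T n")
        case True
        have "\<bar>esym (chi U) {..<n} k\<bar> \<le> T n ^ k"
          using True T2 by (intro abs_esym_le_power) (simp_all add: s chi_square)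
        then have "\<bar>l\<bar> \<le> T n ^ k / real (n choose k)"
          by (simp add: l_def abs_divide divide_right_mono)
        then have "(1 + l) ^ L n \<le> A n"
          unfolding A_def using assms(1) n kT T0 L by (intro central_term_le) auto
        then have "(1 + l) ^ L n / 2 ^ n \<le> A n / 2 ^ n" by (simp add: divide_right_mono)
        moreover have "0 \<le> B n * (1 / real (n choose card U))" using nonneg by simp
        ultimately show ?thesis unfolding l_def by linarith
      next
        case False
        have x: "(real n - 2 * real m) / real n = 1 - 2 * (real m / real n)"
          using n0 by (simp add: field_simps)
        have "\<bar>l\<bar> \<le> \<bar>1 - 2 * (real m / real n)\<bar> ^ k + C / real n"
          using C(2)[of n "{..<n}" "chi U"] n by (simp add: l_def s x chi_square)
        from outer_term_le[OF assms(2) t n0 m L C(1) this]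
        have "(1 + l) ^ L n / 2 ^ n \<le>
            exp (K - \<epsilon> * (real n * (1 - 2 * (real m / real n))\<^sup>2 / 4)) / real (n choose m)"
          by (simp add: K_def \<epsilon>_def)
        also have "\<dots> \<le> B n / real (n choose m)"
        proof -
          have "(T n)\<^sup>2 \<le> \<bar>real n - 2 * real m\<bar>\<^sup>2"
            using False T0 by (intro power_mono) auto
          then have "(T n)\<^sup>2 / real n \<le> (real n - 2 * real m)\<^sup>2 / real n"
            by (simp add: divide_right_mono)
          also have "\<dots> = real n * (1 - 2 * (real m / real n))\<^sup>2"
            unfolding x[symmetric] using n0 by (simp add: power2_eq_square)
          finally have "\<epsilon> * ((T n)\<^sup>2 / real n / 4) \<le> \<epsilon> * (real n * (1 - 2 * (real m / real n))\<^sup>2 / 4)"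
            using \<epsilon> by (intro mult_left_mono) auto
          then show ?thesis unfolding B_def by (intro divide_right_mono) auto
        qed
        finally have "(1 + l) ^ L n / 2 ^ n \<le> B n * (1 / real (n choose card U))" by (simp add: m_def)
        moreover have "0 \<le> A n / 2 ^ n" using nonneg by simp
        ultimately show ?thesis unfolding l_def by linarith
      qed
    qed
    then have "expected_Y (L n) n k
        \<le> (\<Sum>U\<in>Pow {..<n}. A n / 2 ^ n + B n * (1 / real (n choose card U)))"
      unfolding expected_Y_fourier[OF n] sum_divide_distrib by (rule sum_mono)
    also have "\<dots> = A n + B n * (real n + 1)"
      unfolding sum.distrib sum_distrib_left[symmetric] sum_inverse_binomial_Pow
      by (simp add: card_Pow)
    finally show ?thesis .
  qed
  have lim: "(\<lambda>n. A n + B n * (real n + 1)) \<longlonglongrightarrow> 1"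
  proof -
    have "(\<lambda>n. (c * real n + 1) * (real k * (real n powr (3/5)) / real n) ^ 3) \<longlonglongrightarrow> 0"
      using assms(2) k0 by real_asymp
    then have "A \<longlonglongrightarrow> exp 0" unfolding A_def[abs_def] T_def by (intro tendsto_exp)
    moreover have "(\<lambda>n. exp (K - \<epsilon> * ((real n powr (3/5))\<^sup>2 / real n / 4)) * (real n + 1)) \<longlonglongrightarrow> 0"
      using \<epsilon> by real_asymp
    then have "(\<lambda>n. B n * (real n + 1)) \<longlonglongrightarrow> 0" by (simp add: B_def T_def)
    ultimately show ?thesis using tendsto_add by fastforce
  qed
  have "eventually (\<lambda>n. real k * T n \<le> real n) sequentially"
    unfolding T_def by real_asymp
  then have le: "eventually (\<lambda>n. expected_Y (L n) n k \<le> A n + B n * (real n + 1)) sequentially"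
    using eventually_ge_at_top[of k] by eventually_elim (rule upper)
  have ge: "eventually (\<lambda>n. 1 \<le> expected_Y (L n) n k) sequentially"
    using eventually_ge_at_top[of k] by eventually_elim (rule expected_Y_ge_1)
  show ?thesis
    by (rule tendsto_sandwich[OF ge le tendsto_const lim])
qed

end
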